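(* Let $(e_n)$ be a uniformly quasi-greedy basic sequence in a Banach lattice $X$. Then $\mathbf{k}^\vee_m=\mathcal{O}(\log_2 m)$ as $m\to\infty$.
   Context: $(e_n)$ is a semi-normalized basic sequence with span $E$ and biorthogonal functionals $e_n^*$. For $x\in E$, the natural greedy ordering $\rho$ lists indices by non-increasing $|e_n^*(x)|$ (ties broken by increasing index, range containing $\{n:e_n^*(x)\ne0\}$); $\mathcal{G}_m(x)=\sum_{n=1}^m e^*_{\rho(n)}(x)e_{\rho(n)}$. The sequence is uniformly quasi-greedy if $\sup_m\sup_{\|x\|=1}\|\bigvee_{n\le m}|\mathcal{G}_n(x)|\|<\infty$. For an ordered finite set $A=\{n_1,\dots,n_m\}\subseteq\mathbb{N}$, $P^\vee_A(x)=\bigvee_{i=1}^m\big|\sum_{k=1}^ie^*_{n_k}(x)e_{n_k}\big|$ and $\|P^\vee_A\|=\sup_{x\in E,\|x\|=1}\|P^\vee_A(x)\|$. Finally $\mathbf{k}^\vee_m=\sup\{\|P^\vee_A\|: A \text{ an ordered subset of }\mathbb{N},\ |A|\le m\}$. *)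

theory Defs
  imports "HOL-Analysis.Analysis" "HOL-Library.Lattice_Algebras" "HOL-Library.Landau_Symbols"
begin

text \<open>Banach lattice: real Banach space, vector lattice (ordered real vector space
  whose order is a lattice), with absolute value |x| = sup x (-x), and a lattice norm.\<close>
class banach_lattice = banach + ordered_real_vector + lattice_ab_group_add_abs +
  assumes lattice_norm: "\<bar>x\<bar> \<le> \<bar>y\<bar> \<Longrightarrow> norm x \<le> norm y"

text \<open>Closed linear span of the sequence.\<close>
definition cspan :: "(nat \<Rightarrow> 'a::real_normed_vector) \<Rightarrow> 'a set" where
  "cspan e = closure (span (range e))"

text \<open>Basic sequence: a Schauder basis of its closed linear span.\<close>
definition basic_sequence :: "(nat \<Rightarrow> 'a::real_normed_vector) \<Rightarrow> bool" where
  "basic_sequence e \<longleftrightarrow>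
     (\<forall>x \<in> cspan e. \<exists>!a::nat \<Rightarrow> real. (\<lambda>N. \<Sum>k<N. a k *\<^sub>R e k) \<longlonglongrightarrow> x)"

definition semi_normalized :: "(nat \<Rightarrow> 'a::real_normed_vector) \<Rightarrow> bool" where
  "semi_normalized e \<longleftrightarrow> (\<exists>c C. 0 < c \<and> (\<forall>n. c \<le> norm (e n) \<and> norm (e n) \<le> C))"

text \<open>Biorthogonal (coefficient) functionals: coef e n x = e_n^*(x).\<close>
definition coef :: "(nat \<Rightarrow> 'a::real_normed_vector) \<Rightarrow> nat \<Rightarrow> 'a \<Rightarrow> real" where
  "coef e n x = (THE a::nat \<Rightarrow> real. (\<lambda>N. \<Sum>k<N. a k *\<^sub>R e k) \<longlonglongrightarrow> x) n"

text \<open>Greedy order: i precedes j iff |a i| > |a j|, ties broken by increasing index.\<close>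
definition greedy_prec :: "(nat \<Rightarrow> real) \<Rightarrow> nat \<Rightarrow> nat \<Rightarrow> bool" where
  "greedy_prec a i j \<longleftrightarrow> \<bar>a j\<bar> < \<bar>a i\<bar> \<or> (\<bar>a i\<bar> = \<bar>a j\<bar> \<and> i < j)"

text \<open>Position (0-based) of an index j of the support in the natural greedy ordering.\<close>
definition greedy_rank :: "(nat \<Rightarrow> real) \<Rightarrow> nat \<Rightarrow> nat" where
  "greedy_rank a j = card {i. a i \<noteq> 0 \<and> greedy_prec a i j}"

text \<open>The indices rho(1),...,rho(m) carrying nonzero coefficients.\<close>
definition greedy_set :: "(nat \<Rightarrow> real) \<Rightarrow> nat \<Rightarrow> nat set" where
  "greedy_set a m = {j. a j \<noteq> 0 \<and> greedy_rank a j < m}"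

text \<open>Greedy approximant G_m(x).\<close>
definition greedy_approx :: "(nat \<Rightarrow> 'a::real_normed_vector) \<Rightarrow> nat \<Rightarrow> 'a \<Rightarrow> 'a" where
  "greedy_approx e m x = (\<Sum>j \<in> greedy_set (\<lambda>n. coef e n x) m. coef e j x *\<^sub>R e j)"

text \<open>Finite lattice supremum of a list (of positive elements; empty sup is 0).\<close>
fun lsup :: "'a::{lattice, zero} list \<Rightarrow> 'a" where
  "lsup [] = 0"
| "lsup [x] = x"
| "lsup (x # y # xs) = sup x (lsup (y # xs))"

definition uniformly_quasi_greedy :: "(nat \<Rightarrow> 'a::banach_lattice) \<Rightarrow> bool" where
  "uniformly_quasi_greedy e \<longleftrightarrow>
     (\<exists>C. \<forall>m. \<forall>x \<in> cspan e. norm x = 1 \<longrightarrow>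
        norm (lsup (map (\<lambda>n. \<bar>greedy_approx e n x\<bar>) [1..<m+1])) \<le> C)"

text \<open>P^vee_A(x) for an ordered finite set A = [n_1,...,n_k] (distinct list).\<close>
definition Pvee :: "(nat \<Rightarrow> 'a::banach_lattice) \<Rightarrow> nat list \<Rightarrow> 'a \<Rightarrow> 'a" where
  "Pvee e A x = lsup (map (\<lambda>i. \<bar>\<Sum>k<i. coef e (A ! k) x *\<^sub>R e (A ! k)\<bar>) [1..<length A + 1])"

definition Pvee_norm :: "(nat \<Rightarrow> 'a::banach_lattice) \<Rightarrow> nat list \<Rightarrow> real" where
  "Pvee_norm e A = Sup {norm (Pvee e A x) | x. x \<in> cspan e \<and> norm x = 1}"

definition kvee :: "(nat \<Rightarrow> 'a::banach_lattice) \<Rightarrow> nat \<Rightarrow> real" where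
  "kvee e m = Sup {Pvee_norm e A | A. distinct A \<and> length A \<le> m}"

end

theory Submission
  imports Defs
begin

text \<open>Fix \<open>x\<close> of norm one. The quasi-greedy property bounds all coefficients \<open>e\<^sup>*\<^sub>n(x)\<close> by a
  constant \<open>K\<close>. The coefficients along \<open>A\<close> above \<open>K/m\<close> fall into \<open>\<lceil>log\<^sub>2 m\<rceil>\<close> dyadic bands
  \<open>(t/2, t]\<close>, \<open>t = K 2\<^sup>-\<^sup>j\<close>; the others contribute \<open>O(1)\<close> to \<open>P\<^sup>\<or>\<^sub>A(x)\<close>. A layer-cake decomposition
  bounds the contribution of one band by \<open>t\<close> times that of the signs \<open>sgn e\<^sup>*\<^sub>n(x)\<close> on subsets of
  the band. Perturbing such signs so that the greedy algorithm selects them in the order of \<open>A\<close>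
  bounds their maximal partial sums by the quasi-greedy constant times the norm of the signed sum
  over the whole band, and that norm is \<open>O(1/t)\<close> because the band is the difference of two
  threshold sets. Thus each band contributes \<open>O(1)\<close>.\<close>

section \<open>Lattice estimates and maximal partial sums\<close>

lemma scaleR_sup_distrib:
  fixes x y :: "'a::{ordered_real_vector, lattice}"
  assumes "0 < c"
  shows "c *\<^sub>R sup x y = sup (c *\<^sub>R x) (c *\<^sub>R y)"
proof (rule antisym)
  have "x \<le> inverse c *\<^sub>R sup (c *\<^sub>R x) (c *\<^sub>R y)" "y \<le> inverse c *\<^sub>R sup (c *\<^sub>R x) (c *\<^sub>R y)"
    using scaleR_left_mono[of "c *\<^sub>R x" "sup (c *\<^sub>R x) (c *\<^sub>R y)" "inverse c"]
      scaleR_left_mono[of "c *\<^sub>R y" "sup (c *\<^sub>R x) (c *\<^sub>R y)" "inverse c"] assms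
    by simp_all
  hence "c *\<^sub>R sup x y \<le> c *\<^sub>R (inverse c *\<^sub>R sup (c *\<^sub>R x) (c *\<^sub>R y))"
    using assms by (intro scaleR_left_mono) auto
  thus "c *\<^sub>R sup x y \<le> sup (c *\<^sub>R x) (c *\<^sub>R y)"
    using assms by simp
  show "sup (c *\<^sub>R x) (c *\<^sub>R y) \<le> c *\<^sub>R sup x y"
    using assms by (auto intro!: scaleR_left_mono)
qed

lemma abs_scaleR_lattice:
  fixes x :: "'a::{ordered_real_vector, lattice_ab_group_add_abs}"
  shows "\<bar>c *\<^sub>R x\<bar> = \<bar>c\<bar> *\<^sub>R \<bar>x\<bar>"
proof -
  have nonneg: "\<bar>d *\<^sub>R z\<bar> = d *\<^sub>R \<bar>z\<bar>" if "0 \<le> d" for d and z :: 'a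
    using that scaleR_sup_distrib[of d z "-z"] by (cases "d = 0") (auto simp: abs_lattice)
  show ?thesis
  proof (cases "0 \<le> c")
    case False
    hence "\<bar>c *\<^sub>R x\<bar> = (- c) *\<^sub>R \<bar>- x\<bar>"
      using nonneg[of "- c" "- x"] by simp
    thus ?thesis using False by simp
  qed (simp add: nonneg)
qed

lemma norm_abs_lattice: "norm \<bar>x::'a::banach_lattice\<bar> = norm x"
  by (rule antisym; rule lattice_norm; simp)

lemma norm_mono_lattice:
  fixes x y :: "'a::banach_lattice"
  assumes "0 \<le> x" "x \<le> y"
  shows "norm x \<le> norm y"
  using assms by (intro lattice_norm) (simp add: abs_of_nonneg)

lemma lsup_upper: "y \<in> set xs \<Longrightarrow> y \<le> lsup (xs::'a::{lattice, zero} list)"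
  by (induction xs rule: lsup.induct) (auto intro: le_supI2)

lemma lsup_least:
  "(\<And>y. y \<in> set xs \<Longrightarrow> y \<le> b) \<Longrightarrow> 0 \<le> b \<Longrightarrow> lsup (xs::'a::{lattice, zero} list) \<le> b"
  by (induction xs rule: lsup.induct) auto

lemma lsup_nonneg:
  "(\<And>y. y \<in> set xs \<Longrightarrow> 0 \<le> y) \<Longrightarrow> 0 \<le> lsup (xs::'a::{lattice, zero} list)"
  by (induction xs rule: lsup.induct) (auto intro: le_supI1)

lemma lsup_map_scaleR:
  fixes ys :: "'a::{ordered_real_vector, lattice} list"
  assumes "0 < c"
  shows "lsup (map ((*\<^sub>R) c) ys) = c *\<^sub>R lsup ys"
  by (induction ys rule: lsup.induct) (simp_all add: scaleR_sup_distrib[OF assms])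

definition partial_sums_sup :: "(nat \<Rightarrow> 'a::banach_lattice) \<Rightarrow> nat \<Rightarrow> (nat \<Rightarrow> real) \<Rightarrow> 'a" where
  "partial_sums_sup f L c = lsup (map (\<lambda>i. \<bar>\<Sum>k<i. c k *\<^sub>R f k\<bar>) [1..<L+1])"

lemma partial_sums_sup_nonneg: "0 \<le> partial_sums_sup f L c"
  unfolding partial_sums_sup_def by (rule lsup_nonneg) auto

lemma partial_sums_sup_upper:
  "1 \<le> i \<Longrightarrow> i \<le> L \<Longrightarrow> \<bar>\<Sum>k<i. c k *\<^sub>R f k\<bar> \<le> partial_sums_sup f L c"
  unfolding partial_sums_sup_def by (intro lsup_upper) (force simp: image_iff)

lemma partial_sums_sup_least:
  "(\<And>i. 1 \<le> i \<Longrightarrow> i \<le> L \<Longrightarrow> \<bar>\<Sum>k<i. c k *\<^sub>R f k\<bar> \<le> b) \<Longrightarrow> 0 \<le> b \<Longrightarrow>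
    partial_sums_sup f L c \<le> b"
  unfolding partial_sums_sup_def by (rule lsup_least) auto

lemma partial_sums_sup_cong:
  "(\<And>k. k < L \<Longrightarrow> c k = c' k) \<Longrightarrow> partial_sums_sup f L c = partial_sums_sup f L c'"
  unfolding partial_sums_sup_def
  by (intro arg_cong[where f=lsup] map_cong refl arg_cong[where f=abs] sum.cong) auto

lemma partial_sums_sup_zero: "partial_sums_sup f L (\<lambda>k. 0) = 0"
  by (rule antisym[OF partial_sums_sup_least partial_sums_sup_nonneg]) auto

lemma partial_sums_sup_add:
  "partial_sums_sup f L (\<lambda>k. c k + d k) \<le> partial_sums_sup f L c + partial_sums_sup f L d"
proof (rule partial_sums_sup_least)
  fix i assume i: "1 \<le> i" "i \<le> L"
  have "\<bar>\<Sum>k<i. (c k + d k) *\<^sub>R f k\<bar> = \<bar>(\<Sum>k<i. c k *\<^sub>R f k) + (\<Sum>k<i. d k *\<^sub>R f k)\<bar>"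
    by (simp add: scaleR_add_left sum.distrib)
  also have "\<dots> \<le> \<bar>\<Sum>k<i. c k *\<^sub>R f k\<bar> + \<bar>\<Sum>k<i. d k *\<^sub>R f k\<bar>"
    by (rule abs_triangle_ineq)
  also have "\<dots> \<le> partial_sums_sup f L c + partial_sums_sup f L d"
    using i by (intro add_mono partial_sums_sup_upper)
  finally show "\<bar>\<Sum>k<i. (c k + d k) *\<^sub>R f k\<bar> \<le> partial_sums_sup f L c + partial_sums_sup f L d" .
qed (simp add: partial_sums_sup_nonneg)

lemma partial_sums_sup_scaleR:
  assumes "0 \<le> v"
  shows "partial_sums_sup f L (\<lambda>k. v * c k) \<le> v *\<^sub>R partial_sums_sup f L c"
proof (rule partial_sums_sup_least)
  fix i assume i: "1 \<le> i" "i \<le> L"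
  have "(\<Sum>k<i. (v * c k) *\<^sub>R f k) = v *\<^sub>R (\<Sum>k<i. c k *\<^sub>R f k)"
    by (simp add: scaleR_sum_right)
  hence "\<bar>\<Sum>k<i. (v * c k) *\<^sub>R f k\<bar> = v *\<^sub>R \<bar>\<Sum>k<i. c k *\<^sub>R f k\<bar>"
    using assms by (simp add: abs_scaleR_lattice)
  also have "\<dots> \<le> v *\<^sub>R partial_sums_sup f L c"
    using assms i by (intro scaleR_left_mono partial_sums_sup_upper)
  finally show "\<bar>\<Sum>k<i. (v * c k) *\<^sub>R f k\<bar> \<le> v *\<^sub>R partial_sums_sup f L c" .
qed (use assms in \<open>auto intro!: scaleR_nonneg_nonneg partial_sums_sup_nonneg\<close>)

lemma norm_partial_sums_sup_add:
  "norm (partial_sums_sup f L (\<lambda>k. c k + d k))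
     \<le> norm (partial_sums_sup f L c) + norm (partial_sums_sup f L d)"
  by (rule order_trans[OF norm_mono_lattice norm_triangle_ineq])
     (intro partial_sums_sup_nonneg partial_sums_sup_add)+

lemma norm_partial_sums_sup_scaleR:
  assumes "0 \<le> v"
  shows "norm (partial_sums_sup f L (\<lambda>k. v * c k)) \<le> v * norm (partial_sums_sup f L c)"
  using norm_mono_lattice[OF partial_sums_sup_nonneg partial_sums_sup_scaleR[OF assms]] assms
  by simp

lemma norm_partial_sums_sup_sum:
  assumes "finite J"
  shows "norm (partial_sums_sup f L (\<lambda>k. \<Sum>j\<in>J. c j k)) \<le> (\<Sum>j\<in>J. norm (partial_sums_sup f L (c j)))"
  using assms
proof (induction J rule: finite_induct)
  case (insert j J)
  have "norm (partial_sums_sup f L (\<lambda>k. \<Sum>j\<in>insert j J. c j k))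
      = norm (partial_sums_sup f L (\<lambda>k. c j k + (\<Sum>j\<in>J. c j k)))"
    using insert by simp
  also have "\<dots> \<le> norm (partial_sums_sup f L (c j)) + norm (partial_sums_sup f L (\<lambda>k. \<Sum>j\<in>J. c j k))"
    by (rule norm_partial_sums_sup_add)
  finally show ?case using insert by simp
qed (simp add: partial_sums_sup_zero)

lemma norm_partial_sums_sup_le_sum:
  "norm (partial_sums_sup f L c) \<le> (\<Sum>k<L. \<bar>c k\<bar> * norm (f k))"
proof -
  have "partial_sums_sup f L c \<le> (\<Sum>k<L. \<bar>c k\<bar> *\<^sub>R \<bar>f k\<bar>)"
  proof (rule partial_sums_sup_least)
    fix i assume "i \<le> L"
    have "\<bar>\<Sum>k<i. c k *\<^sub>R f k\<bar> \<le> (\<Sum>k<i. \<bar>c k\<bar> *\<^sub>R \<bar>f k\<bar>)"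
      using sum_abs[of "\<lambda>k. c k *\<^sub>R f k" "{..<i}"] by (simp add: abs_scaleR_lattice)
    also have "\<dots> \<le> (\<Sum>k<L. \<bar>c k\<bar> *\<^sub>R \<bar>f k\<bar>)"
      using \<open>i \<le> L\<close> by (intro sum_mono2) (auto intro: scaleR_nonneg_nonneg)
    finally show "\<bar>\<Sum>k<i. c k *\<^sub>R f k\<bar> \<le> (\<Sum>k<L. \<bar>c k\<bar> *\<^sub>R \<bar>f k\<bar>)" .
  qed (auto intro!: sum_nonneg scaleR_nonneg_nonneg)
  hence "norm (partial_sums_sup f L c) \<le> norm (\<Sum>k<L. \<bar>c k\<bar> *\<^sub>R \<bar>f k\<bar>)"
    by (intro norm_mono_lattice partial_sums_sup_nonneg)
  also have "\<dots> \<le> (\<Sum>k<L. \<bar>c k\<bar> * norm (f k))"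
    using norm_sum[of "\<lambda>k. \<bar>c k\<bar> *\<^sub>R \<bar>f k\<bar>" "{..<L}"] by (simp add: norm_abs_lattice)
  finally show ?thesis .
qed

lemma Pvee_eq_partial_sums_sup:
  "Pvee e A x = partial_sums_sup (\<lambda>k. sgn (coef e (A ! k) x) *\<^sub>R e (A ! k)) (length A)
                  (\<lambda>k. \<bar>coef e (A ! k) x\<bar>)"
  unfolding Pvee_def partial_sums_sup_def by (simp add: abs_mult_sgn)

section \<open>Layer-cake decomposition and real estimates\<close>

lemma card_positive_values_shift_less:
  fixes c :: "nat \<Rightarrow> real"
  assumes "finite I" "v \<in> c ` I" "0 < v"
  shows "card ((\<lambda>k. if v \<le> c k then c k - v else 0) ` I \<inter> {0<..}) < card (c ` I \<inter> {0<..})"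
proof -
  let ?V = "c ` I \<inter> {0<..}"
  have "(\<lambda>k. if v \<le> c k then c k - v else 0) ` I \<inter> {0<..} \<subseteq> (\<lambda>y. y - v) ` (?V - {v})"
  proof
    fix y assume "y \<in> (\<lambda>k. if v \<le> c k then c k - v else 0) ` I \<inter> {0<..}"
    then obtain k where "k \<in> I" "y = c k - v" "0 < y" by (auto split: if_splits)
    hence "c k \<in> ?V - {v}" using assms(3) by auto
    thus "y \<in> (\<lambda>y. y - v) ` (?V - {v})" using \<open>y = c k - v\<close> by blast
  qed
  hence "card ((\<lambda>k. if v \<le> c k then c k - v else 0) ` I \<inter> {0<..}) \<le> card (?V - {v})"
    using assms(1) by (meson card_image_le card_mono finite_Diff finite_Int finite_imageI order_trans)
  also have "\<dots> < card ?V"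
    using assms by (intro card_Diff1_less) auto
  finally show ?thesis .
qed

lemma sublinear_le_of_level_sets:
  fixes \<Phi> :: "(nat \<Rightarrow> real) \<Rightarrow> real" and \<S> :: "nat set set"
  assumes I: "finite I"
    and subadd: "\<And>c d. \<Phi> (\<lambda>k. c k + d k) \<le> \<Phi> c + \<Phi> d"
    and homog: "\<And>v c. 0 \<le> v \<Longrightarrow> \<Phi> (\<lambda>k. v * c k) \<le> v * \<Phi> c"
    and level_bound: "\<And>T. T \<in> \<S> \<Longrightarrow> \<Phi> (indicator T) \<le> B" and B: "0 \<le> B"
  shows "\<lbrakk>\<forall>k. 0 \<le> c k \<and> c k \<le> s; \<forall>k. k \<notin> I \<longrightarrow> c k = 0; \<forall>v>0. {k. v \<le> c k} \<in> \<S>\<rbrakk>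
           \<Longrightarrow> \<Phi> c \<le> s * B"
proof (induction "card (c ` I \<inter> {0<..})" arbitrary: c s rule: less_induct)
  case less
  note c_range = less.prems(1) and c_supp = less.prems(2) and c_levels = less.prems(3)
  define V where "V = c ` I \<inter> {0<..}"
  have "finite V" using I by (simp add: V_def)
  have "0 \<le> s" using c_range by (meson order_trans)
  show ?case
  proof (cases "V = {}")
    case True
    hence "c k = 0" for k
      using c_range c_supp by (cases "k \<in> I") (auto simp: V_def order_less_le)
    hence "c = (\<lambda>k. 0 * c k)" by (simp add: fun_eq_iff)
    hence "\<Phi> c \<le> 0" using homog[of 0 c] by simp
    thus ?thesis using \<open>0 \<le> s\<close> B by (simp add: order_trans)
  next
    case False
    define v where "v = Min V"
    have "v \<in> V" using False \<open>finite V\<close> by (simp add: v_def)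
    hence "0 < v" "v \<le> s" "v \<in> c ` I" using c_range by (auto simp: V_def)
    have below_v: "c k = 0" if "c k < v" for k
      using that c_range c_supp Min_le[OF \<open>finite V\<close>, of "c k"]
      by (cases "k \<in> I") (auto simp: v_def V_def order_less_le)
    define T where "T = {k. v \<le> c k}"
    define c' where "c' k = (if v \<le> c k then c k - v else 0)" for k
    have "c = (\<lambda>k. v * indicator T k + c' k)"
      using below_v by (force simp: c'_def T_def)
    hence "\<Phi> c \<le> v * \<Phi> (indicator T) + \<Phi> c'"
      using subadd[of "\<lambda>k. v * indicator T k" c'] homog[of v "indicator T"] \<open>0 < v\<close> by simp
    moreover have "\<Phi> (indicator T) \<le> B"
      using level_bound c_levels \<open>0 < v\<close> by (simp add: T_def)
    moreover have "\<Phi> c' \<le> (s - v) * B"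
    proof (rule less.hyps)
      show "card (c' ` I \<inter> {0<..}) < card (c ` I \<inter> {0<..})"
        unfolding c'_def using card_positive_values_shift_less[OF I \<open>v \<in> c ` I\<close> \<open>0 < v\<close>] .
      show "\<forall>k. 0 \<le> c' k \<and> c' k \<le> s - v"
        using c_range \<open>v \<le> s\<close> by (simp add: c'_def)
      show "\<forall>k. k \<notin> I \<longrightarrow> c' k = 0"
        using c_supp \<open>0 < v\<close> by (simp add: c'_def)
      have "{k. u \<le> c' k} = {k. u + v \<le> c k}" if "0 < u" for u
        using that by (auto simp: c'_def)
      thus "\<forall>u>0. {k. u \<le> c' k} \<in> \<S>"
        using c_levels \<open>0 < v\<close> by (simp add: add_pos_pos)
    qed
    ultimately have "\<Phi> c \<le> v * B + (s - v) * B"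
      using \<open>0 < v\<close> by (smt (verit) mult_left_mono)
    thus ?thesis by (simp add: algebra_simps)
  qed
qed

lemma sum_dyadic_bands:
  fixes y K :: real
  assumes "0 \<le> y" "y \<le> K"
  shows "(\<Sum>j<J. if K / 2^j / 2 < y \<and> y \<le> K / 2^j then y else 0) + (if y \<le> K / 2^J then y else 0) = y"
proof (induction J)
  case (Suc J)
  have "(if K / 2^J / 2 < y \<and> y \<le> K / 2^J then y else 0) + (if y \<le> K / 2^Suc J then y else 0)
        = (if y \<le> K / 2^J then y else 0)"
    using assms mult_left_mono[of "2^J" "2 * 2^J" y] by (auto simp: field_simps)
  thus ?case using Suc by simp
qed (use assms in simp)

lemma le_of_forall_pos_le_add_mult:
  fixes x y M :: real
  assumes "\<And>\<delta>. 0 < \<delta> \<Longrightarrow> x \<le> y + \<delta> * M"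
  shows "x \<le> y"
proof (rule field_le_epsilon)
  fix \<epsilon> :: real assume "0 < \<epsilon>"
  hence "x \<le> y + \<epsilon> / (\<bar>M\<bar> + 1) * M" by (intro assms) simp
  also have "\<epsilon> / (\<bar>M\<bar> + 1) * M \<le> \<epsilon>"
    using \<open>0 < \<epsilon>\<close> mult_left_mono[of M "\<bar>M\<bar> + 1" \<epsilon>] by (simp add: field_simps)
  finally show "x \<le> y + \<epsilon>" by simp
qed

lemma real_le_two_power_ceiling_log:
  assumes "1 \<le> m"
  shows "real m \<le> 2 ^ nat \<lceil>log 2 (real m)\<rceil>"
proof -
  have "real m = 2 powr log 2 (real m)" using assms by simp
  also have "\<dots> \<le> 2 powr real (nat \<lceil>log 2 (real m)\<rceil>)"
    by (intro powr_mono) linarith+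
  finally show ?thesis by (simp add: powr_realpow)
qed

lemma Sup_nonneg_le:
  fixes S :: "real set"
  assumes "S \<noteq> {}" "\<And>y. y \<in> S \<Longrightarrow> 0 \<le> y \<and> y \<le> B"
  shows "0 \<le> Sup S \<and> Sup S \<le> B"
proof
  show "Sup S \<le> B" using assms by (intro cSup_least) auto
  obtain y where "y \<in> S" using assms(1) by blast
  moreover have "bdd_above S" using assms(2) by (intro bdd_aboveI[of _ B]) blast
  ultimately have "y \<le> Sup S" by (rule cSup_upper)
  thus "0 \<le> Sup S" using assms \<open>y \<in> S\<close> by force
qed

section \<open>Coefficient functionals of a basic sequence\<close>

lemma sum_in_span_range: "(\<Sum>j\<in>F. b j *\<^sub>R e j) \<in> span (range e)"
  by (intro span_sum span_scale span_base) simp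

lemma sum_in_cspan: "(\<Sum>j\<in>F. b j *\<^sub>R e j) \<in> cspan e"
  unfolding cspan_def by (rule set_mp[OF closure_subset sum_in_span_range])

lemma in_cspan_of_LIMSEQ:
  assumes "(\<lambda>N. \<Sum>k<N. b k *\<^sub>R e k) \<longlonglongrightarrow> y"
  shows "y \<in> cspan e"
  unfolding cspan_def closure_sequential
  using assms by (intro exI[where x="\<lambda>N. \<Sum>k<N. b k *\<^sub>R e k"]) (auto intro: sum_in_span_range)

context
  fixes e :: "nat \<Rightarrow> 'a::real_normed_vector"
  assumes basic: "basic_sequence e"
begin

lemma coef_LIMSEQ:
  assumes "x \<in> cspan e"
  shows "(\<lambda>N. \<Sum>k<N. coef e k x *\<^sub>R e k) \<longlonglongrightarrow> x"
proof -
  have "\<exists>!a. (\<lambda>N. \<Sum>k<N. a k *\<^sub>R e k) \<longlonglongrightarrow> x"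
    using basic assms unfolding basic_sequence_def by blast
  from theI'[OF this] show ?thesis unfolding coef_def .
qed

lemma coef_eqI:
  assumes "(\<lambda>N. \<Sum>k<N. b k *\<^sub>R e k) \<longlonglongrightarrow> x"
  shows "coef e n x = b n"
proof -
  have "\<exists>!a. (\<lambda>N. \<Sum>k<N. a k *\<^sub>R e k) \<longlonglongrightarrow> x"
    using basic in_cspan_of_LIMSEQ[OF assms] unfolding basic_sequence_def by blast
  from the1_equality[where P="\<lambda>a. (\<lambda>N. \<Sum>k<N. a k *\<^sub>R e k) \<longlonglongrightarrow> x", OF this assms]
  show ?thesis unfolding coef_def by simp
qed

lemma coef_sum:
  assumes "finite F"
  shows "coef e n (\<Sum>j\<in>F. b j *\<^sub>R e j) = (if n \<in> F then b n else 0)"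
proof -
  define b' where "b' n = (if n \<in> F then b n else 0)" for n
  obtain M where M: "\<And>j. j \<in> F \<Longrightarrow> j < M"
    using assms finite_nat_bounded by blast
  have "(\<Sum>k<N. b' k *\<^sub>R e k) = (\<Sum>j\<in>F. b j *\<^sub>R e j)" if "M \<le> N" for N
  proof -
    have "F \<subseteq> {..<N}" using M that by force
    hence "(\<Sum>k<N. b' k *\<^sub>R e k) = (\<Sum>k\<in>F. b' k *\<^sub>R e k)"
      by (intro sum.mono_neutral_right) (auto simp: b'_def)
    thus ?thesis by (simp add: b'_def)
  qed
  hence "eventually (\<lambda>N. (\<Sum>k<N. b' k *\<^sub>R e k) = (\<Sum>j\<in>F. b j *\<^sub>R e j)) sequentially"
    unfolding eventually_sequentially by blast
  hence "(\<lambda>N. \<Sum>k<N. b' k *\<^sub>R e k) \<longlonglongrightarrow> (\<Sum>j\<in>F. b j *\<^sub>R e j)"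
    by (rule tendsto_eventually)
  from coef_eqI[OF this] show ?thesis by (simp add: b'_def)
qed

lemma coef_zero: "coef e n 0 = 0"
  using coef_sum[of "{}"] by simp

lemma LIMSEQ_coef_scaleR:
  assumes "x \<in> cspan e"
  shows "(\<lambda>N. \<Sum>k<N. (c * coef e k x) *\<^sub>R e k) \<longlonglongrightarrow> c *\<^sub>R x"
  using tendsto_scaleR[OF tendsto_const coef_LIMSEQ[OF assms], of c]
  by (simp add: scaleR_sum_right)

lemma coef_scaleR: "x \<in> cspan e \<Longrightarrow> coef e n (c *\<^sub>R x) = c * coef e n x"
  by (rule coef_eqI[OF LIMSEQ_coef_scaleR])

lemma scaleR_in_cspan: "x \<in> cspan e \<Longrightarrow> c *\<^sub>R x \<in> cspan e"
  by (rule in_cspan_of_LIMSEQ[OF LIMSEQ_coef_scaleR])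

lemma coef_LIMSEQ_0:
  assumes "semi_normalized e" "x \<in> cspan e"
  shows "(\<lambda>n. coef e n x) \<longlonglongrightarrow> 0"
proof -
  obtain c where c: "0 < c" "\<And>n. c \<le> norm (e n)"
    using assms(1) unfolding semi_normalized_def by blast
  have "summable (\<lambda>k. coef e k x *\<^sub>R e k)"
    using coef_LIMSEQ[OF assms(2)] unfolding summable_def sums_def by blast
  hence "(\<lambda>k. norm (coef e k x *\<^sub>R e k) / c) \<longlonglongrightarrow> 0"
    by (intro tendsto_divide_zero tendsto_norm_zero summable_LIMSEQ_zero)
  moreover have "norm (coef e k x) \<le> norm (coef e k x *\<^sub>R e k) / c" for k
  proof -
    have "\<bar>coef e k x\<bar> * c \<le> \<bar>coef e k x\<bar> * norm (e k)"
      using c by (intro mult_left_mono) auto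
    thus ?thesis using c by (simp add: field_simps)
  qed
  ultimately show ?thesis
    using Lim_null_comparison[of "\<lambda>k. coef e k x" "\<lambda>k. norm (coef e k x *\<^sub>R e k) / c"]
    by (auto intro: always_eventually)
qed

end

section \<open>Threshold sets and the greedy ordering\<close>

definition threshold_set :: "(nat \<Rightarrow> real) \<Rightarrow> real \<Rightarrow> nat set" where
  "threshold_set a u = {n. u < \<bar>a n\<bar>}"

definition dyadic_band :: "(nat \<Rightarrow> real) \<Rightarrow> real \<Rightarrow> nat set" where
  "dyadic_band a t = {n. t / 2 < \<bar>a n\<bar> \<and> \<bar>a n\<bar> \<le> t}"

lemma finite_threshold_set_coef:
  assumes "basic_sequence e" "semi_normalized e" "x \<in> cspan e" "0 < u"
  shows "finite (threshold_set (\<lambda>n. coef e n x) u)"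
proof -
  have "eventually (\<lambda>n. norm (coef e n x - 0) < u) sequentially"
    using coef_LIMSEQ_0[OF assms(1-3)] assms(4) unfolding tendsto_iff dist_norm by blast
  then obtain N where N: "\<And>n. n \<ge> N \<Longrightarrow> \<bar>coef e n x\<bar> < u"
    unfolding eventually_sequentially by auto
  have "threshold_set (\<lambda>n. coef e n x) u \<subseteq> {..<N}"
  proof
    fix n assume "n \<in> threshold_set (\<lambda>n. coef e n x) u"
    thus "n \<in> {..<N}" using N[of n] by (cases "N \<le> n") (auto simp: threshold_set_def)
  qed
  thus ?thesis by (rule finite_subset) simp
qed

lemma greedy_prec_trans: "greedy_prec a i j \<Longrightarrow> greedy_prec a j n \<Longrightarrow> greedy_prec a i n"
  by (auto simp: greedy_prec_def)

lemma greedy_prec_total: "i \<noteq> j \<Longrightarrow> greedy_prec a i j \<or> greedy_prec a j i"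
  by (auto simp: greedy_prec_def)

lemma greedy_prec_irrefl: "\<not> greedy_prec a i i"
  by (simp add: greedy_prec_def)

lemma greedy_set_scale:
  assumes "c \<noteq> 0"
  shows "greedy_set (\<lambda>n. c * a n) r = greedy_set a r"
proof -
  have "greedy_prec (\<lambda>n. c * a n) = greedy_prec a"
    using assms by (auto simp: greedy_prec_def abs_mult fun_eq_iff)
  thus ?thesis using assms by (simp add: greedy_set_def greedy_rank_def)
qed

context
  fixes a :: "nat \<Rightarrow> real"
  assumes finite_thresholds: "\<forall>u>0. finite (threshold_set a u)"
begin

lemma finite_greedy_predecessors:
  assumes "a j \<noteq> 0"
  shows "finite {i. a i \<noteq> 0 \<and> greedy_prec a i j}"
proof (rule finite_subset)
  show "{i. a i \<noteq> 0 \<and> greedy_prec a i j} \<subseteq> threshold_set a (\<bar>a j\<bar> / 2)"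
    using assms by (auto simp: threshold_set_def greedy_prec_def)
qed (use assms finite_thresholds in simp)

lemma greedy_rank_less:
  assumes "a j \<noteq> 0" "a n \<noteq> 0" "greedy_prec a j n"
  shows "greedy_rank a j < greedy_rank a n"
  unfolding greedy_rank_def
proof (rule psubset_card_mono)
  show "{i. a i \<noteq> 0 \<and> greedy_prec a i j} \<subset> {i. a i \<noteq> 0 \<and> greedy_prec a i n}"
    using assms greedy_prec_trans greedy_prec_irrefl by blast
qed (rule finite_greedy_predecessors[OF assms(2)])

lemma greedy_set_rank:
  assumes "a n \<noteq> 0"
  shows "greedy_set a (greedy_rank a n) = {i. a i \<noteq> 0 \<and> greedy_prec a i n}"
    and "greedy_set a (Suc (greedy_rank a n)) = insert n (greedy_set a (greedy_rank a n))"
proof -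
  have "greedy_prec a j n" if "a j \<noteq> 0" "greedy_rank a j \<le> greedy_rank a n" "j \<noteq> n" for j
    using that assms greedy_prec_total greedy_rank_less[of n j] by fastforce
  moreover have "greedy_rank a j < greedy_rank a n" if "a j \<noteq> 0" "greedy_prec a j n" for j
    using greedy_rank_less[OF that(1) assms that(2)] .
  ultimately show "greedy_set a (greedy_rank a n) = {i. a i \<noteq> 0 \<and> greedy_prec a i n}"
    and "greedy_set a (Suc (greedy_rank a n)) = insert n (greedy_set a (greedy_rank a n))"
    using assms greedy_prec_irrefl by (force simp: greedy_set_def)+
qed

lemma greedy_set_threshold_set:
  assumes "0 < u"
  shows "greedy_set a (card (threshold_set a u)) = threshold_set a u"
proof (intro set_eqI iffI)
  have fin: "finite (threshold_set a u)" using finite_thresholds assms by blast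
  fix j
  assume j: "j \<in> greedy_set a (card (threshold_set a u))"
  hence "a j \<noteq> 0" and rank: "greedy_rank a j < card (threshold_set a u)"
    by (auto simp: greedy_set_def)
  show "j \<in> threshold_set a u"
  proof (rule ccontr)
    assume "j \<notin> threshold_set a u"
    hence "threshold_set a u \<subseteq> {i. a i \<noteq> 0 \<and> greedy_prec a i j}"
      using assms by (auto simp: threshold_set_def greedy_prec_def)
    hence "card (threshold_set a u) \<le> greedy_rank a j"
      unfolding greedy_rank_def by (intro card_mono finite_greedy_predecessors \<open>a j \<noteq> 0\<close>)
    thus False using rank by simp
  qed
next
  have fin: "finite (threshold_set a u)" using finite_thresholds assms by blast
  fix j assume j: "j \<in> threshold_set a u"
  hence "a j \<noteq> 0" using assms by (auto simp: threshold_set_def)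
  have "{i. a i \<noteq> 0 \<and> greedy_prec a i j} \<subseteq> threshold_set a u - {j}"
    using j by (auto simp: threshold_set_def greedy_prec_def)
  hence "greedy_rank a j \<le> card (threshold_set a u - {j})"
    unfolding greedy_rank_def by (intro card_mono) (use fin in auto)
  also have "\<dots> < card (threshold_set a u)" using fin j by (rule card_Diff1_less)
  finally show "j \<in> greedy_set a (card (threshold_set a u))"
    using \<open>a j \<noteq> 0\<close> by (simp add: greedy_set_def)
qed

end

lemma threshold_set_boosted:
  fixes b :: "nat \<Rightarrow> real" and A :: "nat list"
  assumes boosted: "\<And>k. k \<in> S \<Longrightarrow> \<bar>b (A ! k)\<bar> = 1 + \<delta> * (real L - real k)"
    and others: "\<And>n. n \<notin> (\<lambda>k. A ! k) ` S \<Longrightarrow> \<bar>b n\<bar> \<le> 1"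
    and "0 < \<delta>" "i \<le> L"
  shows "threshold_set b (1 + \<delta> * (real L - real i)) = (\<lambda>k. A ! k) ` {k \<in> S. k < i}"
proof (intro set_eqI iffI)
  fix n assume n: "n \<in> threshold_set b (1 + \<delta> * (real L - real i))"
  have "0 \<le> \<delta> * (real L - real i)" using assms by simp
  hence "n \<in> (\<lambda>k. A ! k) ` S" using n others[of n] by (force simp: threshold_set_def)
  then obtain k where "k \<in> S" "n = A ! k" by blast
  moreover from this have "k < i"
    using n boosted[of k] \<open>0 < \<delta>\<close> by (simp add: threshold_set_def)
  ultimately show "n \<in> (\<lambda>k. A ! k) ` {k \<in> S. k < i}" by blast
next
  fix n assume "n \<in> (\<lambda>k. A ! k) ` {k \<in> S. k < i}"
  then obtain k where "k \<in> S" "k < i" "n = A ! k" by blast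
  thus "n \<in> threshold_set b (1 + \<delta> * (real L - real i))"
    using boosted[of k] \<open>0 < \<delta>\<close> by (simp add: threshold_set_def)
qed

lemma level_sets_threshold_weights:
  fixes a :: "nat \<Rightarrow> real"
  assumes s: "0 < s" and v: "0 < v"
  shows "\<exists>w \<ge> s. {k. v \<le> (if k \<in> threshold_set a s then s / \<bar>a k\<bar> else 0)}
                 = threshold_set a s - threshold_set a w"
proof (cases "v \<le> 1")
  case True
  have "v \<le> s / \<bar>a k\<bar> \<longleftrightarrow> \<bar>a k\<bar> \<le> s / v" if "k \<in> threshold_set a s" for k
    using that s v by (simp add: threshold_set_def le_divide_eq mult.commute)
  hence "{k. v \<le> (if k \<in> threshold_set a s then s / \<bar>a k\<bar> else 0)}
       = threshold_set a s - threshold_set a (s / v)"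
    using v by (auto simp: threshold_set_def not_less)
  moreover have "s \<le> s / v" using True s v by (simp add: field_simps)
  ultimately show ?thesis by blast
next
  case False
  have "s / \<bar>a k\<bar> < 1" if "k \<in> threshold_set a s" for k
    using that s by (simp add: threshold_set_def)
  hence "{k. v \<le> (if k \<in> threshold_set a s then s / \<bar>a k\<bar> else 0)} = {}"
    using False v by (auto simp: not_le intro: less_trans)
  thus ?thesis by auto
qed

section \<open>Uniformly quasi-greedy basic sequences\<close>

lemma abs_greedy_approx_le_lsup:
  fixes e :: "nat \<Rightarrow> 'a::banach_lattice"
  assumes "r \<le> m"
  shows "\<bar>greedy_approx e r y\<bar> \<le> lsup (map (\<lambda>n. \<bar>greedy_approx e n y\<bar>) [1..<m+1])"
proof (cases "r = 0")
  case True
  hence "greedy_approx e r y = 0" by (simp add: greedy_approx_def greedy_set_def)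
  moreover have "0 \<le> lsup (map (\<lambda>n. \<bar>greedy_approx e n y\<bar>) [1..<m+1])"
    by (rule lsup_nonneg) auto
  ultimately show ?thesis by simp
qed (rule lsup_upper, use assms in \<open>force simp: image_iff\<close>)

lemma unit_vector_in_cspan:
  assumes "semi_normalized e"
  shows "\<exists>x \<in> cspan e. norm x = 1"
proof -
  have "norm (e 0) \<noteq> 0"
    using assms unfolding semi_normalized_def by (metis not_le order_less_le_trans)
  moreover have "(1 / norm (e 0)) *\<^sub>R e 0 \<in> cspan e"
    using sum_in_cspan[of "\<lambda>_. 1 / norm (e 0)" e "{0}"] by simp
  ultimately show ?thesis by force
qed

locale uniformly_quasi_greedy_basis =
  fixes e :: "nat \<Rightarrow> 'a::banach_lattice" and C :: real
  assumes basic: "basic_sequence e"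
    and semi: "semi_normalized e"
    and greedy_sup_le: "\<And>m x. x \<in> cspan e \<Longrightarrow> norm x = 1 \<Longrightarrow>
          norm (lsup (map (\<lambda>n. \<bar>greedy_approx e n x\<bar>) [1..<m+1])) \<le> C"
begin

lemma C_nonneg: "0 \<le> C"
  using unit_vector_in_cspan[OF semi] greedy_sup_le[of _ 0] norm_ge_zero order_trans by blast

lemma finite_thresholds:
  "x \<in> cspan e \<Longrightarrow> 0 < u \<Longrightarrow> finite (threshold_set (\<lambda>n. coef e n x) u)"
  using finite_threshold_set_coef[OF basic semi] .

lemma greedy_approx_zero: "greedy_approx e r 0 = 0"
  unfolding greedy_approx_def by (simp add: coef_zero[OF basic] greedy_set_def)

lemma greedy_approx_scaleR:
  assumes "x \<in> cspan e"
  shows "greedy_approx e r (t *\<^sub>R x) = t *\<^sub>R greedy_approx e r x"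
proof (cases "t = 0")
  case False
  have "greedy_set (\<lambda>n. coef e n (t *\<^sub>R x)) r = greedy_set (\<lambda>n. coef e n x) r"
    unfolding coef_scaleR[OF basic assms] using greedy_set_scale[OF False] .
  thus ?thesis unfolding greedy_approx_def
    by (simp add: coef_scaleR[OF basic assms] scaleR_sum_right)
qed (simp add: greedy_approx_zero)

lemma norm_greedy_sup_le:
  assumes z: "z \<in> cspan e"
  shows "norm (lsup (map (\<lambda>n. \<bar>greedy_approx e n z\<bar>) [1..<m+1])) \<le> C * norm z"
proof (cases "z = 0")
  case True
  have "lsup (map (\<lambda>n. \<bar>greedy_approx e n z\<bar>) [1..<m+1]) = 0"
    by (intro antisym lsup_least lsup_nonneg) (auto simp: True greedy_approx_zero)
  thus ?thesis using True by simp
next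
  case False
  define x where "x = (1 / norm z) *\<^sub>R z"
  have x: "x \<in> cspan e" "norm x = 1"
    unfolding x_def using scaleR_in_cspan[OF basic z] False by auto
  have "greedy_approx e n z = norm z *\<^sub>R greedy_approx e n x" for n
    using greedy_approx_scaleR[OF x(1), of n "norm z"] False by (simp add: x_def)
  hence map_eq: "map (\<lambda>n. \<bar>greedy_approx e n z\<bar>) ns
      = map ((*\<^sub>R) (norm z)) (map (\<lambda>n. \<bar>greedy_approx e n x\<bar>) ns)" for ns
    by (simp add: abs_scaleR_lattice)
  have "norm (lsup (map (\<lambda>n. \<bar>greedy_approx e n z\<bar>) [1..<m+1]))
      = norm (norm z *\<^sub>R lsup (map (\<lambda>n. \<bar>greedy_approx e n x\<bar>) [1..<m+1]))"
    using False by (simp only: map_eq lsup_map_scaleR[of "norm z"] zero_less_norm_iff simp_thms)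
  also have "\<dots> = norm z * norm (lsup (map (\<lambda>n. \<bar>greedy_approx e n x\<bar>) [1..<m+1]))"
    by simp
  also have "\<dots> \<le> norm z * C"
    using greedy_sup_le[OF x] by (intro mult_left_mono) auto
  finally show ?thesis by (simp add: mult.commute)
qed

lemma norm_greedy_approx_le:
  assumes "z \<in> cspan e"
  shows "norm (greedy_approx e r z) \<le> C * norm z"
proof -
  have "norm \<bar>greedy_approx e r z\<bar> \<le> norm (lsup (map (\<lambda>n. \<bar>greedy_approx e n z\<bar>) [1..<r+1]))"
    by (rule norm_mono_lattice[OF abs_ge_zero abs_greedy_approx_le_lsup]) simp
  thus ?thesis using norm_greedy_sup_le[OF assms, of r] unfolding norm_abs_lattice by linarith
qed

lemma norm_threshold_sum_le:
  assumes x: "x \<in> cspan e" and "0 < u"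
  shows "norm (\<Sum>n\<in>threshold_set (\<lambda>n. coef e n x) u. coef e n x *\<^sub>R e n) \<le> C * norm x"
  using norm_greedy_approx_le[OF x, of "card (threshold_set (\<lambda>n. coef e n x) u)"]
  unfolding greedy_approx_def
  by (subst (asm) greedy_set_threshold_set) (use finite_thresholds[OF x] \<open>0 < u\<close> in blast)+

text \<open>Since ties are broken by the index, consecutive greedy approximants differ by a single term:
  \<open>G\<^sub>r\<^sub>+\<^sub>1 x - G\<^sub>r x = e\<^sup>*\<^sub>n(x) e\<^sub>n\<close> for \<open>r\<close> the greedy rank of \<open>n\<close>.\<close>

lemma abs_coef_mult_norm_le:
  assumes x: "x \<in> cspan e"
  shows "\<bar>coef e n x\<bar> * norm (e n) \<le> 2 * C * norm x"
proof (cases "coef e n x = 0")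
  case False
  define a where "a = (\<lambda>j. coef e j x)"
  define r where "r = greedy_rank a n"
  have fin: "\<forall>u>0. finite (threshold_set a u)"
    unfolding a_def using finite_thresholds[OF x] by blast
  have "a n \<noteq> 0" using False by (simp add: a_def)
  note initial = greedy_set_rank[OF fin \<open>a n \<noteq> 0\<close>, folded r_def]
  have "finite (greedy_set a r)"
    unfolding initial(1) using finite_greedy_predecessors[OF fin \<open>a n \<noteq> 0\<close>] .
  moreover have "n \<notin> greedy_set a r"
    unfolding initial(1) by (simp add: greedy_prec_def)
  ultimately have "(\<Sum>j\<in>greedy_set a (Suc r). coef e j x *\<^sub>R e j)
      = coef e n x *\<^sub>R e n + (\<Sum>j\<in>greedy_set a r. coef e j x *\<^sub>R e j)"
    unfolding initial(2) by simp
  hence "greedy_approx e (Suc r) x = coef e n x *\<^sub>R e n + greedy_approx e r x"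
    unfolding greedy_approx_def a_def .
  hence "\<bar>coef e n x\<bar> * norm (e n) = norm (greedy_approx e (Suc r) x - greedy_approx e r x)"
    by simp
  also have "\<dots> \<le> C * norm x + C * norm x"
    by (rule order_trans[OF norm_triangle_ineq4 add_mono]) (intro norm_greedy_approx_le x)+
  finally show ?thesis by simp
qed (use C_nonneg in simp)

lemma norm_threshold_diff_sum_le:
  assumes x: "x \<in> cspan e" and "0 < s" "s \<le> w"
  shows "norm (\<Sum>n\<in>threshold_set (\<lambda>n. coef e n x) s - threshold_set (\<lambda>n. coef e n x) w.
               coef e n x *\<^sub>R e n) \<le> 2 * C * norm x"
proof -
  define a where "a = (\<lambda>n. coef e n x)"
  have "threshold_set a w \<subseteq> threshold_set a s"
    using \<open>s \<le> w\<close> by (auto simp: threshold_set_def)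
  moreover have "finite (threshold_set a s)"
    unfolding a_def using finite_thresholds[OF x \<open>0 < s\<close>] .
  ultimately have "norm (\<Sum>n\<in>threshold_set a s - threshold_set a w. a n *\<^sub>R e n)
      = norm ((\<Sum>n\<in>threshold_set a s. a n *\<^sub>R e n) - (\<Sum>n\<in>threshold_set a w. a n *\<^sub>R e n))"
    by (simp add: sum_diff)
  also have "\<dots> \<le> C * norm x + C * norm x"
    unfolding a_def using assms
    by (intro order_trans[OF norm_triangle_ineq4 add_mono] norm_threshold_sum_le x) auto
  finally show ?thesis by (simp add: a_def)
qed

text \<open>The weights \<open>s / \<bar>a\<^sub>n\<bar>\<close> lie in \<open>(0, 1]\<close>, and each of their level sets is the difference of
  two threshold sets, on which the greedy bound applies.\<close>

lemma norm_threshold_sign_sum_le: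
  assumes x: "x \<in> cspan e" and s: "0 < s"
  shows "s * norm (\<Sum>n\<in>threshold_set (\<lambda>n. coef e n x) s. sgn (coef e n x) *\<^sub>R e n) \<le> 2 * C * norm x"
proof -
  define a where "a = (\<lambda>n. coef e n x)"
  define I where "I = threshold_set a s"
  have "finite I" unfolding I_def a_def using finite_thresholds[OF x s] .
  define \<Phi> where "\<Phi> \<mu> = norm (\<Sum>n\<in>I. \<mu> n *\<^sub>R (a n *\<^sub>R e n))" for \<mu> :: "nat \<Rightarrow> real"
  define \<mu> where "\<mu> n = (if n \<in> I then s / \<bar>a n\<bar> else 0)" for n
  have "\<Phi> \<mu> \<le> 1 * (2 * C * norm x)"
  proof (rule sublinear_le_of_level_sets[where \<Phi> = \<Phi> and c = \<mu>, OF \<open>finite I\<close>])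
    show "\<Phi> (\<lambda>k. c k + d k) \<le> \<Phi> c + \<Phi> d" for c d
    proof -
      have "(\<Sum>n\<in>I. (c n + d n) *\<^sub>R (a n *\<^sub>R e n))
          = (\<Sum>n\<in>I. c n *\<^sub>R (a n *\<^sub>R e n)) + (\<Sum>n\<in>I. d n *\<^sub>R (a n *\<^sub>R e n))"
        by (simp only: scaleR_add_left sum.distrib)
      thus ?thesis unfolding \<Phi>_def by (simp only: norm_triangle_ineq)
    qed
    show "\<Phi> (\<lambda>k. v * c k) \<le> v * \<Phi> c" if "0 \<le> v" for v c
    proof -
      have "(\<Sum>n\<in>I. (v * c n) *\<^sub>R (a n *\<^sub>R e n)) = v *\<^sub>R (\<Sum>n\<in>I. c n *\<^sub>R (a n *\<^sub>R e n))"
        by (simp add: scaleR_sum_right mult.assoc)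
      thus ?thesis using that unfolding \<Phi>_def by simp
    qed
    show "\<Phi> (indicator T) \<le> 2 * C * norm x" if T_level: "T \<in> {I - threshold_set a w | w. s \<le> w}" for T
    proof -
      obtain w where "s \<le> w" and T: "T = I - threshold_set a w" using T_level by blast
      have "\<Phi> (indicator T) = norm (\<Sum>n\<in>T. a n *\<^sub>R e n)"
        unfolding \<Phi>_def using \<open>finite I\<close>
        by (intro arg_cong[where f=norm] sum.mono_neutral_cong_right) (auto simp: T)
      thus ?thesis
        unfolding T I_def a_def using norm_threshold_diff_sum_le[OF x s \<open>s \<le> w\<close>] by simp
    qed
    show "\<forall>v>0. {k. v \<le> \<mu> k} \<in> {I - threshold_set a w | w. s \<le> w}"
      unfolding \<mu>_def I_def using level_sets_threshold_weights[OF s] by blast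
    show "0 \<le> 2 * C * norm x" using C_nonneg by simp
    show "\<forall>k. 0 \<le> \<mu> k \<and> \<mu> k \<le> 1" using s by (auto simp: \<mu>_def I_def threshold_set_def)
    show "\<forall>k. k \<notin> I \<longrightarrow> \<mu> k = 0" by (simp add: \<mu>_def)
  qed
  moreover have "\<mu> n *\<^sub>R (a n *\<^sub>R e n) = s *\<^sub>R (sgn (a n) *\<^sub>R e n)" if "n \<in> I" for n
    by (simp add: \<mu>_def that real_sgn_eq)
  hence "(\<Sum>n\<in>I. \<mu> n *\<^sub>R (a n *\<^sub>R e n)) = s *\<^sub>R (\<Sum>n\<in>I. sgn (a n) *\<^sub>R e n)"
    unfolding scaleR_sum_right by (rule sum.cong[OF refl])
  hence "\<Phi> \<mu> = s * norm (\<Sum>n\<in>I. sgn (a n) *\<^sub>R e n)"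
    unfolding \<Phi>_def using s by simp
  ultimately show ?thesis unfolding I_def a_def by simp
qed

lemma norm_band_sign_sum_le:
  assumes x: "x \<in> cspan e" and t: "0 < t"
  shows "t * norm (\<Sum>n\<in>dyadic_band (\<lambda>n. coef e n x) t. sgn (coef e n x) *\<^sub>R e n) \<le> 6 * C * norm x"
proof -
  define a where "a = (\<lambda>n. coef e n x)"
  define \<sigma> where "\<sigma> u = (\<Sum>n\<in>threshold_set a u. sgn (a n) *\<^sub>R e n)" for u
  have "dyadic_band a t = threshold_set a (t/2) - threshold_set a t"
    by (auto simp: dyadic_band_def threshold_set_def)
  moreover have "threshold_set a t \<subseteq> threshold_set a (t/2)"
    using t by (auto simp: threshold_set_def)
  moreover have "finite (threshold_set a (t/2))"
    unfolding a_def using finite_thresholds[OF x] t by simp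
  ultimately have "(\<Sum>n\<in>dyadic_band a t. sgn (a n) *\<^sub>R e n) = \<sigma> (t/2) - \<sigma> t"
    unfolding \<sigma>_def by (simp add: sum_diff)
  hence "t * norm (\<Sum>n\<in>dyadic_band a t. sgn (a n) *\<^sub>R e n) \<le> t * (norm (\<sigma> (t/2)) + norm (\<sigma> t))"
    using t by (simp add: mult_left_mono norm_triangle_ineq4)
  also have "\<dots> = 2 * ((t/2) * norm (\<sigma> (t/2))) + t * norm (\<sigma> t)"
    by (simp add: algebra_simps)
  also have "\<dots> \<le> 2 * (2 * C * norm x) + 2 * C * norm x"
    unfolding \<sigma>_def a_def using t
    by (intro add_mono mult_left_mono norm_threshold_sign_sum_le x) auto
  finally show ?thesis unfolding a_def by simp
qed

lemma greedy_approx_boosted: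
  fixes A :: "nat list" and \<sigma> :: "nat \<Rightarrow> real"
  assumes A: "distinct A" and D: "finite D" and signs: "\<And>n. n \<in> D \<Longrightarrow> \<bar>\<sigma> n\<bar> = 1"
    and S: "S \<subseteq> {k. k < length A \<and> A ! k \<in> D}" and \<delta>: "0 < \<delta>" and i: "i \<le> length A"
  defines "w n \<equiv> \<Sum>k\<in>S. if A ! k = n then real (length A) - real k else 0"
  shows "greedy_approx e (card {k \<in> S. k < i}) (\<Sum>n\<in>D. (\<sigma> n * (1 + \<delta> * w n)) *\<^sub>R e n)
       = (\<Sum>k\<in>{k \<in> S. k < i}. (1 + \<delta> * (real (length A) - real k)) *\<^sub>R (\<sigma> (A ! k) *\<^sub>R e (A ! k)))"
proof -
  define L where "L = length A"
  define y where "y = (\<Sum>n\<in>D. (\<sigma> n * (1 + \<delta> * w n)) *\<^sub>R e n)"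
  define b where "b n = coef e n y" for n
  have inj: "inj_on (\<lambda>k. A ! k) S" using S by (intro inj_on_nth A) auto
  have "finite S" by (rule finite_subset[of _ "{..<length A}"]) (use S in auto)
  have w_boosted: "w (A ! k) = real L - real k" if "k \<in> S" for k
  proof -
    have "w (A ! k) = (\<Sum>k'\<in>S. if k' = k then real L - real k' else 0)"
      unfolding w_def L_def using inj_onD[OF inj _ _ that] that by (intro sum.cong) auto
    thus ?thesis using that \<open>finite S\<close> by simp
  qed
  have w_other: "w n = 0" if "n \<notin> (\<lambda>k. A ! k) ` S" for n
    unfolding w_def using that by (intro sum.neutral) auto
  have b: "b n = (if n \<in> D then \<sigma> n * (1 + \<delta> * w n) else 0)" for n
    unfolding b_def y_def by (rule coef_sum[OF basic D])
  have b_boosted: "\<bar>b (A ! k)\<bar> = 1 + \<delta> * (real L - real k)" if "k \<in> S" for k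
    using that S \<delta> signs[of "A ! k"] w_boosted[OF that] by (auto simp: b abs_mult L_def)
  have b_other: "\<bar>b n\<bar> \<le> 1" if "n \<notin> (\<lambda>k. A ! k) ` S" for n
    using signs[of n] w_other[OF that] by (simp add: b abs_mult)
  have "\<forall>u>0. finite (threshold_set b u)"
    using D by (auto simp: threshold_set_def b intro: finite_subset)
  moreover have "card ((\<lambda>k. A ! k) ` {k \<in> S. k < i}) = card {k \<in> S. k < i}"
    using inj by (intro card_image inj_on_subset[OF inj]) auto
  ultimately have "greedy_set b (card {k \<in> S. k < i}) = (\<lambda>k. A ! k) ` {k \<in> S. k < i}"
    using greedy_set_threshold_set[of b "1 + \<delta> * (real L - real i)"] \<delta> i
      threshold_set_boosted[OF b_boosted b_other \<delta> i[folded L_def]] by (simp add: L_def add_pos_nonneg)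
  hence "greedy_approx e (card {k \<in> S. k < i}) y = (\<Sum>k\<in>{k \<in> S. k < i}. b (A ! k) *\<^sub>R e (A ! k))"
    unfolding greedy_approx_def b_def[abs_def]
    by (simp add: sum.reindex inj_on_subset[OF inj])
  also have "\<dots> = (\<Sum>k\<in>{k \<in> S. k < i}. (1 + \<delta> * (real L - real k)) *\<^sub>R (\<sigma> (A ! k) *\<^sub>R e (A ! k)))"
    using S by (intro sum.cong) (auto simp: b w_boosted mult.commute)
  finally show ?thesis unfolding y_def L_def .
qed

lemma partial_sums_sup_indicator_le_boosted:
  fixes A :: "nat list" and \<sigma> :: "nat \<Rightarrow> real"
  assumes A: "distinct A" and D: "finite D" and signs: "\<And>n. n \<in> D \<Longrightarrow> \<bar>\<sigma> n\<bar> = 1"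
    and S: "S \<subseteq> {k. k < length A \<and> A ! k \<in> D}" and "0 < \<delta>"
  defines "L \<equiv> length A" and "f \<equiv> \<lambda>k. \<sigma> (A ! k) *\<^sub>R e (A ! k)"
    and "w n \<equiv> \<Sum>k\<in>S. if A ! k = n then real (length A) - real k else 0"
  shows "partial_sums_sup f L (indicator S)
           \<le> lsup (map (\<lambda>n. \<bar>greedy_approx e n (\<Sum>n\<in>D. (\<sigma> n * (1 + \<delta> * w n)) *\<^sub>R e n)\<bar>) [1..<L+1])
             + \<delta> *\<^sub>R (\<Sum>k\<in>S. (real L - real k) *\<^sub>R \<bar>f k\<bar>)"
    (is "_ \<le> ?G + \<delta> *\<^sub>R ?W")
proof (rule partial_sums_sup_least)
  have "S \<subseteq> {..<L}" using S by (auto simp: L_def)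
  have "0 \<le> ?W"
    using \<open>S \<subseteq> {..<L}\<close> by (intro sum_nonneg scaleR_nonneg_nonneg) auto
  thus "0 \<le> ?G + \<delta> *\<^sub>R ?W"
    using \<open>0 < \<delta>\<close> by (intro add_nonneg_nonneg scaleR_nonneg_nonneg lsup_nonneg) auto
  fix i assume "1 \<le> i" "i \<le> L"
  define K where "K = {k \<in> S. k < i}"
  define R where "R = (\<Sum>k\<in>K. (real L - real k) *\<^sub>R f k)"
  have "card K \<le> card {..<i}" unfolding K_def by (intro card_mono) auto
  hence G_bound: "\<bar>greedy_approx e (card K) (\<Sum>n\<in>D. (\<sigma> n * (1 + \<delta> * w n)) *\<^sub>R e n)\<bar> \<le> ?G"
    using \<open>i \<le> L\<close> by (intro abs_greedy_approx_le_lsup) simp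
  have "\<bar>R\<bar> \<le> (\<Sum>k\<in>K. \<bar>(real L - real k) *\<^sub>R f k\<bar>)"
    unfolding R_def by (rule sum_abs)
  also have "\<dots> = (\<Sum>k\<in>K. (real L - real k) *\<^sub>R \<bar>f k\<bar>)"
    using \<open>S \<subseteq> {..<L}\<close> by (intro sum.cong) (auto simp: K_def abs_scaleR_lattice)
  also have "\<dots> \<le> ?W"
    unfolding K_def using \<open>S \<subseteq> {..<L}\<close> finite_subset[OF \<open>S \<subseteq> {..<L}\<close>]
    by (intro sum_mono2) (auto intro!: scaleR_nonneg_nonneg)
  finally have R_bound: "\<bar>R\<bar> \<le> ?W" .
  have "(\<Sum>k<i. indicator S k *\<^sub>R f k) = (\<Sum>k<i. if k \<in> S then f k else 0)"
    by (intro sum.cong) (auto simp: indicator_def)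
  also have "\<dots> = (\<Sum>k\<in>K. f k)"
    unfolding K_def by (simp add: sum.inter_filter[symmetric] conj_commute)
  also have "\<dots> = (\<Sum>k\<in>K. (1 + \<delta> * (real L - real k)) *\<^sub>R f k) - \<delta> *\<^sub>R R"
    unfolding R_def by (simp add: scaleR_add_left sum.distrib scaleR_sum_right)
  also have "(\<Sum>k\<in>K. (1 + \<delta> * (real L - real k)) *\<^sub>R f k)
      = greedy_approx e (card K) (\<Sum>n\<in>D. (\<sigma> n * (1 + \<delta> * w n)) *\<^sub>R e n)"
    unfolding K_def w_def f_def L_def
    using greedy_approx_boosted[OF A D signs S \<open>0 < \<delta>\<close>] \<open>i \<le> L\<close> by (simp add: L_def)
  finally have "\<bar>\<Sum>k<i. indicator S k *\<^sub>R f k\<bar>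
      \<le> \<bar>greedy_approx e (card K) (\<Sum>n\<in>D. (\<sigma> n * (1 + \<delta> * w n)) *\<^sub>R e n)\<bar> + \<bar>\<delta> *\<^sub>R R\<bar>"
    by (simp only: abs_triangle_ineq4)
  also have "\<dots> \<le> ?G + \<delta> *\<^sub>R ?W"
    using G_bound R_bound \<open>0 < \<delta>\<close> by (simp add: abs_scaleR_lattice add_mono scaleR_left_mono)
  finally show "\<bar>\<Sum>k<i. indicator S k *\<^sub>R f k\<bar> \<le> ?G + \<delta> *\<^sub>R ?W" .
qed

text \<open>Raising the coefficients along \<open>A\<close> by a small strictly decreasing amount makes the greedy
  algorithm pick them first and in the order of \<open>A\<close>; letting the perturbation vanish gives the bound.\<close>

lemma norm_partial_sums_sup_signs_le:
  fixes A :: "nat list" and \<sigma> :: "nat \<Rightarrow> real"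
  assumes A: "distinct A" and D: "finite D" and signs: "\<And>n. n \<in> D \<Longrightarrow> \<bar>\<sigma> n\<bar> = 1"
    and S: "S \<subseteq> {k. k < length A \<and> A ! k \<in> D}"
  shows "norm (partial_sums_sup (\<lambda>k. \<sigma> (A ! k) *\<^sub>R e (A ! k)) (length A) (indicator S))
           \<le> C * norm (\<Sum>n\<in>D. \<sigma> n *\<^sub>R e n)"
proof -
  define L where "L = length A"
  define f where "f = (\<lambda>k. \<sigma> (A ! k) *\<^sub>R e (A ! k))"
  define w where "w n = (\<Sum>k\<in>S. if A ! k = n then real L - real k else 0)" for n
  define W where "W = (\<Sum>k\<in>S. (real L - real k) *\<^sub>R \<bar>f k\<bar>)"
  define y0 where "y0 = (\<Sum>n\<in>D. \<sigma> n *\<^sub>R e n)"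
  define y1 where "y1 = (\<Sum>n\<in>D. (\<sigma> n * w n) *\<^sub>R e n)"
  have "norm (partial_sums_sup f L (indicator S)) \<le> C * norm y0 + \<delta> * (C * norm y1 + norm W)"
    if "0 < \<delta>" for \<delta>
  proof -
    define y where "y = (\<Sum>n\<in>D. (\<sigma> n * (1 + \<delta> * w n)) *\<^sub>R e n)"
    define G where "G = lsup (map (\<lambda>n. \<bar>greedy_approx e n y\<bar>) [1..<L+1])"
    have "norm (partial_sums_sup f L (indicator S)) \<le> norm (G + \<delta> *\<^sub>R W)"
      using partial_sums_sup_indicator_le_boosted[OF A D signs S \<open>0 < \<delta>\<close>]
      unfolding G_def y_def W_def w_def f_def L_def by (rule norm_mono_lattice[OF partial_sums_sup_nonneg])
    also have "\<dots> \<le> norm G + \<delta> * norm W"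
      using norm_triangle_ineq[of G "\<delta> *\<^sub>R W"] \<open>0 < \<delta>\<close> by simp
    also have "norm G \<le> C * norm y"
      unfolding G_def by (rule norm_greedy_sup_le) (simp add: y_def sum_in_cspan)
    also have "y = y0 + \<delta> *\<^sub>R y1"
      unfolding y_def y0_def y1_def
      by (simp add: algebra_simps scaleR_sum_right sum.distrib scaleR_add_left)
    also have "C * norm (y0 + \<delta> *\<^sub>R y1) \<le> C * (norm y0 + \<delta> * norm y1)"
      using C_nonneg \<open>0 < \<delta>\<close> norm_triangle_ineq[of y0 "\<delta> *\<^sub>R y1"] by (intro mult_left_mono) auto
    finally show ?thesis by (simp add: algebra_simps)
  qed
  hence "norm (partial_sums_sup f L (indicator S)) \<le> C * norm y0"
    by (rule le_of_forall_pos_le_add_mult)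
  thus ?thesis unfolding f_def L_def y0_def .
qed

lemma norm_partial_sums_sup_band_le:
  assumes x: "x \<in> cspan e" and A: "distinct A" and t: "0 < t"
  shows "norm (partial_sums_sup (\<lambda>k. sgn (coef e (A ! k) x) *\<^sub>R e (A ! k)) (length A)
           (\<lambda>k. if k < length A \<and> A ! k \<in> dyadic_band (\<lambda>n. coef e n x) t then \<bar>coef e (A ! k) x\<bar> else 0))
         \<le> 6 * C * C * norm x"
proof -
  define a where "a = (\<lambda>n. coef e n x)"
  define f where "f = (\<lambda>k. sgn (a (A ! k)) *\<^sub>R e (A ! k))"
  define L where "L = length A"
  define I where "I = {k. k < L \<and> A ! k \<in> dyadic_band a t}"
  define B where "B = C * (6 * C * norm x / t)"
  have "dyadic_band a t \<subseteq> threshold_set a (t/2)"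
    by (auto simp: dyadic_band_def threshold_set_def)
  moreover have "finite (threshold_set a (t/2))"
    unfolding a_def using finite_thresholds[OF x] t by simp
  ultimately have "finite (dyadic_band a t)" by (rule finite_subset)
  have "norm (partial_sums_sup f L (indicator T)) \<le> B" if "T \<in> Pow I" for T
  proof -
    have "norm (partial_sums_sup f L (indicator T)) \<le> C * norm (\<Sum>n\<in>dyadic_band a t. sgn (a n) *\<^sub>R e n)"
      unfolding f_def L_def
      by (rule norm_partial_sums_sup_signs_le[OF A \<open>finite (dyadic_band a t)\<close>])
         (use that t in \<open>auto simp: I_def L_def dyadic_band_def abs_sgn_eq\<close>)
    also have "\<dots> \<le> B"
      unfolding B_def using norm_band_sign_sum_le[OF x t] C_nonneg t
      by (intro mult_left_mono) (auto simp: a_def field_simps)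
    finally show ?thesis .
  qed
  hence "norm (partial_sums_sup f L
           (\<lambda>k. if k < L \<and> A ! k \<in> dyadic_band a t then \<bar>a (A ! k)\<bar> else 0)) \<le> t * B"
  proof (rule sublinear_le_of_level_sets[where \<S> = "Pow I", of I, rotated 3])
    show "finite I" by (simp add: I_def)
    show "0 \<le> B" using C_nonneg t by (simp add: B_def)
  qed (use t in \<open>auto simp: I_def dyadic_band_def norm_partial_sums_sup_add norm_partial_sums_sup_scaleR\<close>)
  also have "t * B = 6 * C * C * norm x" using t by (simp add: B_def field_simps)
  finally show ?thesis unfolding a_def f_def L_def .
qed

lemma abs_coef_le:
  assumes "x \<in> cspan e" "0 < c" "c \<le> norm (e n)"
  shows "\<bar>coef e n x\<bar> \<le> 2 * C * norm x / c"
  using abs_coef_mult_norm_le[OF assms(1), of n] mult_left_mono[OF assms(3), of "\<bar>coef e n x\<bar>"] assms(2)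
  by (simp add: field_simps)

lemma norm_Pvee_le_dyadic:
  assumes x: "x \<in> cspan e" and A: "distinct A"
    and K: "0 < K" "\<And>n. \<bar>coef e n x\<bar> \<le> K" and upper: "\<And>n. norm (e n) \<le> Ce"
  shows "norm (Pvee e A x) \<le> real J * (6 * C * C * norm x) + real (length A) * (K / 2^J * Ce)"
proof -
  define L where "L = length A"
  define a where "a = (\<lambda>n. coef e n x)"
  define f where "f = (\<lambda>k. sgn (a (A ! k)) *\<^sub>R e (A ! k))"
  define band where "band j = (\<lambda>k. if k < L \<and> A ! k \<in> dyadic_band a (K / 2^j) then \<bar>a (A ! k)\<bar> else 0)"
    for j
  define rest where "rest k = (if \<bar>a (A ! k)\<bar> \<le> K / 2^J then \<bar>a (A ! k)\<bar> else 0)" for k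
  have "0 \<le> Ce" using norm_ge_zero upper[of 0] by (rule order_trans)
  have "\<bar>a (A ! k)\<bar> = (\<Sum>j<J. band j k) + rest k" if "k < L" for k
    using sum_dyadic_bands[of "\<bar>a (A ! k)\<bar>" K J] K(2) that
    by (simp add: a_def band_def rest_def dyadic_band_def)
  hence "Pvee e A x = partial_sums_sup f L (\<lambda>k. (\<Sum>j<J. band j k) + rest k)"
    unfolding Pvee_eq_partial_sums_sup a_def f_def L_def by (intro partial_sums_sup_cong) simp
  hence "norm (Pvee e A x)
      \<le> norm (partial_sums_sup f L (\<lambda>k. \<Sum>j<J. band j k)) + norm (partial_sums_sup f L rest)"
    by (simp add: norm_partial_sums_sup_add)
  also have "norm (partial_sums_sup f L (\<lambda>k. \<Sum>j<J. band j k))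
      \<le> (\<Sum>j<J. norm (partial_sums_sup f L (band j)))"
    by (rule norm_partial_sums_sup_sum) simp
  also have "\<dots> \<le> (\<Sum>j<J. 6 * C * C * norm x)"
  proof (rule sum_mono)
    fix j
    have "0 < K / 2^j" using K(1) by simp
    from norm_partial_sums_sup_band_le[OF x A this]
    show "norm (partial_sums_sup f L (band j)) \<le> 6 * C * C * norm x"
      unfolding band_def f_def a_def L_def by simp
  qed
  also have "norm (partial_sums_sup f L rest) \<le> (\<Sum>k<L. K / 2^J * Ce)"
  proof (rule order_trans[OF norm_partial_sums_sup_le_sum sum_mono])
    fix k
    have "\<bar>rest k\<bar> \<le> K / 2^J" "norm (f k) \<le> Ce"
      using K(1) \<open>0 \<le> Ce\<close> upper[of "A ! k"] by (auto simp: rest_def f_def abs_sgn_eq)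
    thus "\<bar>rest k\<bar> * norm (f k) \<le> K / 2^J * Ce" using K(1) by (intro mult_mono) auto
  qed
  finally show ?thesis by (simp add: L_def)
qed

lemma norm_Pvee_le_log:
  assumes lower: "0 < c" "\<And>n. c \<le> norm (e n)" and upper: "\<And>n. norm (e n) \<le> Ce"
    and x: "x \<in> cspan e" "norm x = 1" and A: "distinct A" "length A \<le> m" and "2 \<le> m"
  shows "norm (Pvee e A x) \<le> (12 * C * C + (2 * C / c + 1) * Ce) * log 2 (real m)"
proof -
  define K where "K = 2 * C / c + 1"
  define J where "J = nat \<lceil>log 2 (real m)\<rceil>"
  have "0 < K" using C_nonneg lower by (simp add: K_def add_nonneg_pos)
  have "0 \<le> Ce" using lower upper by (meson order_trans less_imp_le)
  have "1 \<le> log 2 (real m)" using \<open>2 \<le> m\<close> by simp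
  have "\<bar>coef e n x\<bar> \<le> K" for n
    using abs_coef_le[OF x(1) lower, of n] x(2) by (simp add: K_def)
  hence "norm (Pvee e A x) \<le> real J * (6 * C * C) + real (length A) * (K / 2^J * Ce)"
    using norm_Pvee_le_dyadic[OF x(1) A(1) \<open>0 < K\<close> _ upper] x(2) by simp
  also have "real (length A) * (K / 2^J * Ce) \<le> 2^J * (K / 2^J * Ce)"
    using A(2) real_le_two_power_ceiling_log[of m] \<open>2 \<le> m\<close> \<open>0 < K\<close> \<open>0 \<le> Ce\<close>
    by (intro mult_right_mono) (auto simp: J_def)
  also have "\<dots> = K * Ce" by simp
  finally have "norm (Pvee e A x) \<le> real J * (6 * C * C) + K * Ce" by simp
  moreover have "real J \<le> 2 * log 2 (real m)"
    using \<open>1 \<le> log 2 (real m)\<close> by (simp add: J_def) linarith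
  hence "real J * (6 * C * C) \<le> 12 * C * C * log 2 (real m)"
    using C_nonneg mult_right_mono[of "real J" "2 * log 2 (real m)" "6 * C * C"] by simp
  moreover have "K * Ce \<le> K * Ce * log 2 (real m)"
    using \<open>1 \<le> log 2 (real m)\<close> \<open>0 < K\<close> \<open>0 \<le> Ce\<close> mult_left_mono[of 1 "log 2 (real m)" "K * Ce"]
    by simp
  ultimately have "norm (Pvee e A x) \<le> 12 * C * C * log 2 (real m) + K * Ce * log 2 (real m)"
    by linarith
  thus ?thesis unfolding K_def by (simp only: distrib_right)
qed

end

theorem proposition3p26:
  fixes e :: "nat \<Rightarrow> 'a::banach_lattice"
  assumes "basic_sequence e" and "semi_normalized e" and "uniformly_quasi_greedy e"
  shows "(\<lambda>m. kvee e m) \<in> O(\<lambda>m. log 2 (real m))"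
proof -
  obtain c Ce where c: "0 < c" "\<And>n. c \<le> norm (e n)" "\<And>n. norm (e n) \<le> Ce"
    using assms(2) unfolding semi_normalized_def by blast
  obtain C where "uniformly_quasi_greedy_basis e C"
    using assms unfolding uniformly_quasi_greedy_def uniformly_quasi_greedy_basis_def by blast
  then interpret uniformly_quasi_greedy_basis e C .
  define Q where "Q = 12 * C * C + (2 * C / c + 1) * Ce"
  have "0 \<le> kvee e m \<and> kvee e m \<le> Q * log 2 (real m)" if "2 \<le> m" for m
  proof -
    have "0 \<le> Pvee_norm e A \<and> Pvee_norm e A \<le> Q * log 2 (real m)"
      if "distinct A" "length A \<le> m" for A
      unfolding Pvee_norm_def using unit_vector_in_cspan[OF semi]
      by (intro Sup_nonneg_le)
         (auto simp: Q_def intro!: norm_Pvee_le_log[OF c] that \<open>2 \<le> m\<close>)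
    moreover have "Pvee_norm e [] \<in> {Pvee_norm e A |A. distinct A \<and> length A \<le> m}" by force
    ultimately show ?thesis unfolding kvee_def by (intro Sup_nonneg_le) blast+
  qed
  hence "\<forall>\<^sub>F m in at_top. norm (kvee e m) \<le> Q * norm (log 2 (real m))"
    unfolding eventually_at_top_linorder by (intro exI[of _ 2]) force
  thus ?thesis by (rule bigoI)
qed

end
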